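(* Let $\mathbb{S}\subset\mathbb{P}_m(\mathbb{C}^{n\times n})$ denote the set of $T$-even polynomials, let $P\in\mathbb{S}$ be regular and let $(\lambda,x)\in\mathbb{C}\times\mathbb{C}^n$ be such that $\|x\|_2=1$ and $P(\lambda)x\ne0$. Let $\mathbb{S}_e$ and $\mathbb{S}_o$ denote the structures of $T$-even and $T$-odd pencils, respectively. Let $L_e\in\mathbb{L}_1(P)$ (resp. $L_o\in\mathbb{L}_1(P)$) be a $T$-even (resp. $T$-odd) linearization of $P$ with right ansatz vector $v$ satisfying $\|v\|_2=1$ and $v=\Sigma v$ (resp. $v=-\Sigma v$). Let $\Lambda_{m-1}:=[\lambda^{m-1},\ldots,\lambda,1]^T$. Then: 1. If $|\lambda|\le1$: $\displaystyle\sqrt{\frac{m+1}{4m}}\le\frac{\eta_2^{\mathbb{S}_e}(\lambda,\Lambda_{m-1}\otimes x,L_e;v)}{\eta_2^{\mathbb{S}}(\lambda,x,P)}\le\sqrt2.$ 2. If $|\lambda|\ge1$: $\displaystyle\sqrt{\frac{m+1}{4m}}\le\frac{\eta_2^{\mathbb{S}_o}(\lambda,\Lambda_{m-1}\otimes x,L_o;v)}{\eta_2^{\mathbb{S}}(\lambda,x,P)}\le\sqrt2$ when $m$ is even, and $\displaystyle\sqrt{\frac{m+1}{2m}}\,\frac{1}{\|(1,\lambda)\|_2}\le\frac{\eta_2^{\mathbb{S}_o}(\lambda,\Lambda_{m-1}\otimes x,L_o;v)}{\eta_2^{\mathbb{S}}(\lambda,x,P)}\le\sqrt2$ when $m$ is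 odd.
   Context: $m,n\ge1$ are integers. $\mathbb{P}_k(\mathbb{C}^{N\times N})$ is the vector space of matrix polynomials $Q(z)=\sum_{j=0}^k z^jA_j$, $A_j\in\mathbb{C}^{N\times N}$. $Q$ is regular if $\det Q(z)\not\equiv0$; $T$-even if $Q(z)^T=Q(-z)$ for all $z$; $T$-odd if $Q(z)^T=-Q(-z)$ for all $z$. $\Sigma:=\mathrm{diag}\{(-1)^{m-1},(-1)^{m-2},\ldots,(-1)^0\}$. $|||Q|||_2:=\left(\sum_{j=0}^k\|A_j\|_2^2\right)^{1/2}$ with $\|\cdot\|_2$ the spectral norm. For $\lambda\in\mathbb{C}$, $u\in\mathbb{C}^N\setminus\{0\}$, a structure class $\mathbb{S}\subset\mathbb{P}_k(\mathbb{C}^{N\times N})$ and regular $Q\in\mathbb{S}$, $\eta_2^{\mathbb{S}}(\lambda,u,Q):=\inf\{|||\Delta Q|||_2:\Delta Q\in\mathbb{S},\ Q(\lambda)u+\Delta Q(\lambda)u=0\}$. $\mathbb{L}_1(P)$ is the set of pencils $L(z)=zX+Y$, $X,Y\in\mathbb{C}^{mn\times mn}$, for which there is $v\in\mathbb{C}^m$ (the right ansatz vector of $L$) with $L(z)\,([z^{m-1},z^{m-2},\ldots,1]^T\otimes I_n)=v\otimes P(z)$ for all $z$; $\otimes$ is the Kronecker product. $L$ is a linearization of $P$ if there are unimodular matrix polynomials $E,F$ with $E(z)L(z)F(z)=\mathrm{diag}(P(z),I_{(m-1)n})$. Structured backward errors of $L_e$ (resp. $L_o$) are taken over all $T$-even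 (resp. $T$-odd) perturbation pencils in $\mathbb{P}_1(\mathbb{C}^{mn\times mn})$; the $v$ in $\eta_2^{\mathbb{S}}(\lambda,\cdot,L;v)$ only records the ansatz vector. *)

theory Defs
  imports "HOL-Analysis.L2_Norm" "Jordan_Normal_Form.Determinant"
begin

text \<open>
  A matrix polynomial is a matrix with polynomial entries. Sizes and degree bounds are explicit
  natural numbers, because pencils of size \<open>m * n\<close> are compared with polynomials of degree at
  most \<open>m\<close> and size \<open>n\<close>.
\<close>

type_synonym matpoly = "complex poly mat"

definition matpolys :: "nat \<Rightarrow> nat \<Rightarrow> matpoly set" where
  "matpolys k N = {Q \<in> carrier_mat N N. \<forall>i<N. \<forall>j<N. degree (Q $$ (i, j)) \<le> k}"

definition eval_mp :: "matpoly \<Rightarrow> complex \<Rightarrow> complex mat" where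
  "eval_mp Q z = map_mat (\<lambda>p. poly p z) Q"

definition coeff_mp :: "matpoly \<Rightarrow> nat \<Rightarrow> complex mat" where
  "coeff_mp Q j = map_mat (\<lambda>p. coeff p j) Q"

lemma eval_mp_eq_sum:
  assumes "Q \<in> matpolys k N" "i < N" "j < N"
  shows "eval_mp Q z $$ (i, j) = (\<Sum>l\<le>k. z ^ l * coeff_mp Q l $$ (i, j))"
proof -
  have "degree (Q $$ (i, j)) \<le> k" and "i < dim_row Q" "j < dim_col Q"
    using assms by (auto simp: matpolys_def)
  moreover from this have "poly (Q $$ (i, j)) z = (\<Sum>l\<le>k. coeff (Q $$ (i, j)) l * z ^ l)"
    unfolding poly_altdef by (intro sum.mono_neutral_left) (auto simp: coeff_eq_0)
  ultimately show ?thesis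
    by (simp add: eval_mp_def coeff_mp_def mult.commute)
qed

definition regular_mp :: "matpoly \<Rightarrow> bool" where
  "regular_mp Q \<longleftrightarrow> (\<exists>z. det (eval_mp Q z) \<noteq> 0)"

definition T_even :: "nat \<Rightarrow> nat \<Rightarrow> matpoly set" where
  "T_even k N = {Q \<in> matpolys k N. \<forall>z. transpose_mat (eval_mp Q z) = eval_mp Q (- z)}"

definition T_odd :: "nat \<Rightarrow> nat \<Rightarrow> matpoly set" where
  "T_odd k N = {Q \<in> matpolys k N. \<forall>z. transpose_mat (eval_mp Q z) = - eval_mp Q (- z)}"

definition norm2_vec :: "complex vec \<Rightarrow> real" where
  "norm2_vec x = L2_set (\<lambda>i. cmod (x $ i)) {..<dim_vec x}"

definition spectral_norm :: "complex mat \<Rightarrow> real" where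
  "spectral_norm A = Sup {norm2_vec (A *\<^sub>v x) | x. x \<in> carrier_vec (dim_col A) \<and> norm2_vec x = 1}"

definition matpoly_norm :: "nat \<Rightarrow> matpoly \<Rightarrow> real" where
  "matpoly_norm k Q = sqrt (\<Sum>j\<le>k. (spectral_norm (coeff_mp Q j))\<^sup>2)"

text \<open>
  The argument \<open>k\<close> is the degree bound of the class \<open>S\<close>. The infimum is taken over the reals; the
  set is bounded below by 0, and it is nonempty whenever \<open>S\<close> is closed under negation and
  \<open>Q \<in> S\<close>, since then \<open>\<Delta>Q = - Q\<close> is admissible.
\<close>

definition structured_backward_error ::
    "nat \<Rightarrow> matpoly set \<Rightarrow> complex \<Rightarrow> complex vec \<Rightarrow> matpoly \<Rightarrow> real" where
  "structured_backward_error k S lam u Q =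
     Inf {matpoly_norm k \<Delta>Q | \<Delta>Q. \<Delta>Q \<in> S \<and>
       eval_mp Q lam *\<^sub>v u + eval_mp \<Delta>Q lam *\<^sub>v u = 0\<^sub>v (dim_row Q)}"

definition kron_mat :: "complex mat \<Rightarrow> complex mat \<Rightarrow> complex mat" where
  "kron_mat A B = mat (dim_row A * dim_row B) (dim_col A * dim_col B)
     (\<lambda>(i, j). A $$ (i div dim_row B, j div dim_col B) * B $$ (i mod dim_row B, j mod dim_col B))"

definition col_mat :: "complex vec \<Rightarrow> complex mat" where
  "col_mat v = mat_of_cols (dim_vec v) [v]"

definition kron_vec :: "complex vec \<Rightarrow> complex vec \<Rightarrow> complex vec" where
  "kron_vec a b = col (kron_mat (col_mat a) (col_mat b)) 0"

lemma kron_vec_altdef: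
  "kron_vec a b =
     vec (dim_vec a * dim_vec b) (\<lambda>i. a $ (i div dim_vec b) * b $ (i mod dim_vec b))"
proof (rule eq_vecI)
  fix i assume "i < dim_vec (vec (dim_vec a * dim_vec b)
    (\<lambda>i. a $ (i div dim_vec b) * b $ (i mod dim_vec b)))"
  then have i: "i < dim_vec a * dim_vec b" by simp
  then have "0 < dim_vec b" by (cases "dim_vec b = 0") auto
  with i show "kron_vec a b $ i = vec (dim_vec a * dim_vec b)
    (\<lambda>i. a $ (i div dim_vec b) * b $ (i mod dim_vec b)) $ i"
    by (simp add: kron_vec_def kron_mat_def col_mat_def mat_of_cols_def less_mult_imp_div_less)
qed (simp add: kron_vec_def kron_mat_def col_mat_def mat_of_cols_def)

text \<open>\<open>Lam m z\<close> is the vector \<open>[z^(m-1), ..., z, 1]\<close> of length \<open>m\<close>.\<close>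

definition Lam :: "nat \<Rightarrow> complex \<Rightarrow> complex vec" where
  "Lam m z = vec m (\<lambda>i. z ^ (m - 1 - i))"

definition Sigma_mat :: "nat \<Rightarrow> complex mat" where
  "Sigma_mat m = mat_diag m (\<lambda>i. (-1) ^ (m - 1 - i))"

definition right_ansatz_vector :: "nat \<Rightarrow> nat \<Rightarrow> matpoly \<Rightarrow> matpoly \<Rightarrow> complex vec \<Rightarrow> bool" where
  "right_ansatz_vector m n P L v \<longleftrightarrow> v \<in> carrier_vec m \<and>
     (\<forall>z. eval_mp L z * kron_mat (col_mat (Lam m z)) (1\<^sub>m n) = kron_mat (col_mat v) (eval_mp P z))"

definition L1 :: "nat \<Rightarrow> nat \<Rightarrow> matpoly \<Rightarrow> matpoly set" where
  "L1 m n P = {L \<in> matpolys 1 (m * n). \<exists>v. right_ansatz_vector m n P L v}"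

definition unimodular_mp :: "nat \<Rightarrow> matpoly \<Rightarrow> bool" where
  "unimodular_mp N E \<longleftrightarrow> E \<in> carrier_mat N N \<and> (\<exists>c. c \<noteq> 0 \<and> det E = [:c:])"

definition is_linearization :: "nat \<Rightarrow> nat \<Rightarrow> matpoly \<Rightarrow> matpoly \<Rightarrow> bool" where
  "is_linearization m n P L \<longleftrightarrow>
     (\<exists>E F. unimodular_mp (m * n) E \<and> unimodular_mp (m * n) F \<and>
        E * L * F = four_block_mat P (0\<^sub>m n ((m - 1) * n)) (0\<^sub>m ((m - 1) * n) n) (1\<^sub>m ((m - 1) * n)))"

end

theory Submission
  imports Defs
begin

text \<open>
  Let \<open>r = P(lam) x\<close>. Any admissible perturbation of degree \<open>k\<close> has norm at least
  \<open>norm r / (norm u * sqrt (\<Sum>l\<le>k. \<bar>lam\<bar>^(2l)))\<close>, by Cauchy-Schwarz. Conversely \<open>q(z) A\<close> is admissible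
  when \<open>q\<close> is a scalar even (odd) polynomial with \<open>q(lam) = 1\<close> and \<open>A\<close> is a complex symmetric matrix
  sending \<open>u\<close> to minus the residual; \<open>A\<close> can be chosen with the least possible spectral norm. The
  ansatz identity makes the residual of the pencil at \<open>\<Lambda> \<otimes> x\<close> equal to \<open>v \<otimes> r\<close>, of norm \<open>norm r\<close>,
  so the ratio is controlled by the sums of \<open>t^l\<close>, \<open>t = \<bar>lam\<bar>^2\<close>, over \<open>l \<le> m\<close>, over \<open>l < m\<close> and over even
  \<open>l \<le> m\<close>. The crude two-sided bounds already suffice: no skew-symmetric perturbation is needed.
\<close>

lemma of_real_cmod_square: "(complex_of_real (cmod z))\<^sup>2 = z * cnj z"
  by (metis complex_norm_square of_real_power)

lemma sum_cmod_square_orthogonal: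
  fixes f g :: "'a \<Rightarrow> complex"
  assumes "(\<Sum>i\<in>I. f i * cnj (g i)) = 0"
  shows "(\<Sum>i\<in>I. (cmod (s * f i + t * g i))\<^sup>2) =
    (cmod s)\<^sup>2 * (\<Sum>i\<in>I. (cmod (f i))\<^sup>2) + (cmod t)\<^sup>2 * (\<Sum>i\<in>I. (cmod (g i))\<^sup>2)"
proof -
  have ortho': "(\<Sum>i\<in>I. cnj (f i) * g i) = 0"
    using arg_cong[OF assms, of cnj] by (simp add: cnj_sum)
  have "complex_of_real (\<Sum>i\<in>I. (cmod (s * f i + t * g i))\<^sup>2) =
    (\<Sum>i\<in>I. s * cnj s * (f i * cnj (f i)) + t * cnj t * (g i * cnj (g i))
      + s * cnj t * (f i * cnj (g i)) + cnj s * t * (cnj (f i) * g i))"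
    by (simp add: of_real_cmod_square algebra_simps)
  also have "\<dots> = s * cnj s * (\<Sum>i\<in>I. f i * cnj (f i)) + t * cnj t * (\<Sum>i\<in>I. g i * cnj (g i))
      + s * cnj t * (\<Sum>i\<in>I. f i * cnj (g i)) + cnj s * t * (\<Sum>i\<in>I. cnj (f i) * g i)"
    by (simp add: sum.distrib sum_distrib_left)
  also have "\<dots> = complex_of_real ((cmod s)\<^sup>2 * (\<Sum>i\<in>I. (cmod (f i))\<^sup>2)
      + (cmod t)\<^sup>2 * (\<Sum>i\<in>I. (cmod (g i))\<^sup>2))"
    using assms ortho' by (simp add: of_real_cmod_square)
  finally show ?thesis
    using of_real_eq_iff by blast
qed

lemma bessel_two:
  fixes f g y :: "'a \<Rightarrow> complex"
  assumes ortho: "(\<Sum>i\<in>I. f i * cnj (g i)) = 0"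
    and f: "(\<Sum>i\<in>I. f i * cnj (f i)) * s = (\<Sum>i\<in>I. y i * cnj (f i))"
    and g: "(\<Sum>i\<in>I. g i * cnj (g i)) * t = (\<Sum>i\<in>I. y i * cnj (g i))"
  shows "(cmod s)\<^sup>2 * (\<Sum>i\<in>I. (cmod (f i))\<^sup>2) + (cmod t)\<^sup>2 * (\<Sum>i\<in>I. (cmod (g i))\<^sup>2)
    \<le> (\<Sum>i\<in>I. (cmod (y i))\<^sup>2)"
proof -
  define h where "h i = s * f i + t * g i" for i
  define w where "w i = y i - h i" for i
  have ortho': "(\<Sum>i\<in>I. g i * cnj (f i)) = 0"
    using arg_cong[OF ortho, of cnj] by (simp add: cnj_sum mult.commute)
  have wf: "(\<Sum>i\<in>I. w i * cnj (f i)) = 0"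
  proof -
    have "(\<Sum>i\<in>I. w i * cnj (f i)) = (\<Sum>i\<in>I. y i * cnj (f i))
       - (\<Sum>i\<in>I. f i * cnj (f i)) * s - t * (\<Sum>i\<in>I. g i * cnj (f i))"
      unfolding sum_distrib_left sum_distrib_right sum_subtractf[symmetric]
      by (simp add: w_def h_def algebra_simps)
    then show ?thesis using f ortho' by simp
  qed
  have wg: "(\<Sum>i\<in>I. w i * cnj (g i)) = 0"
  proof -
    have "(\<Sum>i\<in>I. w i * cnj (g i)) = (\<Sum>i\<in>I. y i * cnj (g i))
       - (\<Sum>i\<in>I. g i * cnj (g i)) * t - s * (\<Sum>i\<in>I. f i * cnj (g i))"
      unfolding sum_distrib_left sum_distrib_right sum_subtractf[symmetric]
      by (simp add: w_def h_def algebra_simps)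
    then show ?thesis using g ortho by simp
  qed
  have "(\<Sum>i\<in>I. w i * cnj (h i)) = cnj s * (\<Sum>i\<in>I. w i * cnj (f i)) + cnj t * (\<Sum>i\<in>I. w i * cnj (g i))"
    unfolding sum_distrib_left sum.distrib[symmetric] by (simp add: h_def algebra_simps)
  then have "(\<Sum>i\<in>I. w i * cnj (h i)) = 0"
    using wf wg by simp
  from sum_cmod_square_orthogonal[OF this, of 1 1]
  have "(\<Sum>i\<in>I. (cmod (y i))\<^sup>2) = (\<Sum>i\<in>I. (cmod (w i))\<^sup>2) + (\<Sum>i\<in>I. (cmod (h i))\<^sup>2)"
    by (simp add: w_def)
  moreover have "(\<Sum>i\<in>I. (cmod (h i))\<^sup>2) =
      (cmod s)\<^sup>2 * (\<Sum>i\<in>I. (cmod (f i))\<^sup>2) + (cmod t)\<^sup>2 * (\<Sum>i\<in>I. (cmod (g i))\<^sup>2)"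
    unfolding h_def by (rule sum_cmod_square_orthogonal[OF ortho])
  moreover have "0 \<le> (\<Sum>i\<in>I. (cmod (w i))\<^sup>2)"
    by (simp add: sum_nonneg)
  ultimately show ?thesis by simp
qed

text \<open>
  With \<open>a = x\<^sup>T b\<close> and \<open>p = b - a cnj x\<close>, the matrix acts from the span of \<open>x, cnj p\<close> to the span of
  \<open>cnj x, p\<close> and is, in normalised bases, \<open>[[a, c], [c, - cnj a]]\<close> with \<open>c = norm p\<close>: a multiple of
  a unitary matrix. For \<open>p = 0\<close> the last term vanishes because \<open>x / 0 = 0\<close>.
\<close>

lemma exists_symmetric_interpolation_unit:
  fixes x b :: "'a \<Rightarrow> complex"
  assumes fin: "finite I" and x1: "(\<Sum>i\<in>I. (cmod (x i))\<^sup>2) = 1"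
  obtains A where "\<And>i j. A i j = A j i"
    and "\<And>i. i \<in> I \<Longrightarrow> (\<Sum>j\<in>I. A i j * x j) = b i"
    and "\<And>y. (\<Sum>i\<in>I. (cmod (\<Sum>j\<in>I. A i j * y j))\<^sup>2)
           \<le> (\<Sum>i\<in>I. (cmod (b i))\<^sup>2) * (\<Sum>i\<in>I. (cmod (y i))\<^sup>2)"
proof -
  define a where "a = (\<Sum>i\<in>I. x i * b i)"
  define p where "p i = b i - a * cnj (x i)" for i
  define d where "d = (\<Sum>i\<in>I. (cmod (p i))\<^sup>2)"
  define A where "A i j = a * cnj (x i) * cnj (x j) + p i * cnj (x j) + cnj (x i) * p j
     - cnj a / d * p i * p j" for i j
  have xx: "(\<Sum>i\<in>I. x i * cnj (x i)) = 1"
    using arg_cong[OF x1, of complex_of_real] by (simp add: of_real_cmod_square)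
  have pp: "(\<Sum>i\<in>I. cnj (p i) * p i) = complex_of_real d"
    by (simp add: d_def of_real_cmod_square mult.commute)
  have "(\<Sum>i\<in>I. x i * p i) = a - a * (\<Sum>i\<in>I. x i * cnj (x i))"
    unfolding a_def p_def by (simp add: algebra_simps sum_subtractf sum_distrib_left)
  then have xp: "(\<Sum>i\<in>I. x i * p i) = 0"
    by (simp add: xx)
  have xp': "(\<Sum>i\<in>I. cnj (x i) * cnj (p i)) = 0"
    using arg_cong[OF xp, of cnj] by (simp add: cnj_sum)
  have d0: "d \<ge> 0" by (simp add: d_def sum_nonneg)
  have p0: "p i = 0" if "d = 0" "i \<in> I" for i
    using that fin by (simp add: d_def sum_nonneg_eq_0_iff)
  have Ay: "(\<Sum>j\<in>I. A i j * y j) = (a * (\<Sum>j\<in>I. y j * cnj (x j)) + (\<Sum>j\<in>I. y j * p j)) * cnj (x i)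
     + ((\<Sum>j\<in>I. y j * cnj (x j)) - cnj a / d * (\<Sum>j\<in>I. y j * p j)) * p i" for i y
    unfolding sum_distrib_left sum_distrib_right left_diff_distrib distrib_right
      sum_subtractf[symmetric] sum.distrib[symmetric]
    by (intro sum.cong refl) (simp add: A_def algebra_simps)
  have b2: "(\<Sum>i\<in>I. (cmod (b i))\<^sup>2) = (cmod a)\<^sup>2 + d"
    using sum_cmod_square_orthogonal[OF xp', of a 1] x1 by (simp add: p_def d_def)
  show thesis
  proof (rule that[of A])
    show "A i j = A j i" for i j by (simp add: A_def algebra_simps)
    show "(\<Sum>j\<in>I. A i j * x j) = b i" for i
      unfolding Ay using xx xp by (simp add: p_def)
    fix y :: "'a \<Rightarrow> complex"
    define \<alpha> where "\<alpha> = (\<Sum>j\<in>I. y j * cnj (x j))"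
    define \<pi> where "\<pi> = (\<Sum>j\<in>I. y j * p j)"
    have "(\<Sum>i\<in>I. (cmod (\<Sum>j\<in>I. A i j * y j))\<^sup>2)
       = (cmod (a * \<alpha> + \<pi>))\<^sup>2 + (cmod (\<alpha> - cnj a / d * \<pi>))\<^sup>2 * d"
      unfolding Ay \<alpha>_def[symmetric] \<pi>_def[symmetric]
      using sum_cmod_square_orthogonal[OF xp', of "a * \<alpha> + \<pi>" "\<alpha> - cnj a / d * \<pi>"] x1
      by (simp add: d_def)
    also have "\<dots> = ((cmod a)\<^sup>2 + d) * ((cmod \<alpha>)\<^sup>2 + (cmod (\<pi> / d))\<^sup>2 * d)"
    proof (cases "d = 0")
      case True
      then have "\<pi> = 0" using p0 by (simp add: \<pi>_def)
      then show ?thesis using True by (simp add: norm_mult power_mult_distrib)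
    next
      case False
      have "complex_of_real ((cmod (a * \<alpha> + \<pi>))\<^sup>2 + (cmod (\<alpha> - cnj a / d * \<pi>))\<^sup>2 * d)
        = complex_of_real (((cmod a)\<^sup>2 + d) * ((cmod \<alpha>)\<^sup>2 + (cmod (\<pi> / d))\<^sup>2 * d))"
        unfolding of_real_add of_real_mult complex_norm_square
        using False by (simp add: field_simps)
      then show ?thesis using of_real_eq_iff by blast
    qed
    also have "\<dots> \<le> ((cmod a)\<^sup>2 + d) * (\<Sum>i\<in>I. (cmod (y i))\<^sup>2)"
    proof (rule mult_left_mono)
      have "\<pi> = 0" if "d = 0" using p0 that by (simp add: \<pi>_def)
      then have "(cmod \<alpha>)\<^sup>2 * (\<Sum>i\<in>I. (cmod (x i))\<^sup>2)
        + (cmod (\<pi> / d))\<^sup>2 * (\<Sum>i\<in>I. (cmod (cnj (p i)))\<^sup>2) \<le> (\<Sum>i\<in>I. (cmod (y i))\<^sup>2)"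
        by (intro bessel_two)
          (auto simp: xx xp pp \<alpha>_def \<pi>_def)
      then show "(cmod \<alpha>)\<^sup>2 + (cmod (\<pi> / d))\<^sup>2 * d \<le> (\<Sum>i\<in>I. (cmod (y i))\<^sup>2)"
        by (simp add: x1 d_def)
    qed (use d0 in auto)
    finally show "(\<Sum>i\<in>I. (cmod (\<Sum>j\<in>I. A i j * y j))\<^sup>2)
           \<le> (\<Sum>i\<in>I. (cmod (b i))\<^sup>2) * (\<Sum>i\<in>I. (cmod (y i))\<^sup>2)"
      by (simp add: b2)
  qed
qed

lemma norm2_vec_square: "(norm2_vec x)\<^sup>2 = (\<Sum>i<dim_vec x. (cmod (x $ i))\<^sup>2)"
  by (simp add: norm2_vec_def L2_set_def sum_nonneg)

lemma norm2_vec_nonneg [simp]: "norm2_vec x \<ge> 0"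
  by (simp add: norm2_vec_def)

lemma norm2_vec_eq_0_iff: "norm2_vec x = 0 \<longleftrightarrow> x = 0\<^sub>v (dim_vec x)"
  by (auto simp: norm2_vec_def L2_set_eq_0_iff intro: eq_vecI) (metis index_zero_vec(1))

lemma norm2_vec_zero [simp]: "norm2_vec (0\<^sub>v n) = 0"
  by (simp add: norm2_vec_eq_0_iff)

lemma norm2_vec_smult: "norm2_vec (c \<cdot>\<^sub>v x) = cmod c * norm2_vec x"
  by (simp add: norm2_vec_def norm_mult L2_set_right_distrib cong: L2_set_cong_simp)

lemma norm2_vec_uminus: "norm2_vec (- x) = norm2_vec x"
  by (simp add: norm2_vec_def cong: L2_set_cong_simp)

lemma mult_mat_vec_nth:
  assumes "A \<in> carrier_mat r c" "x \<in> carrier_vec c" "i < r"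
  shows "(A *\<^sub>v x) $ i = (\<Sum>j<c. A $$ (i, j) * x $ j)"
  using assms by (simp add: scalar_prod_def lessThan_atLeast0)

lemma norm2_mult_mat_vec_bound:
  obtains K where "\<And>x. x \<in> carrier_vec (dim_col A) \<Longrightarrow> norm2_vec (A *\<^sub>v x) \<le> K * norm2_vec x"
proof
  fix x :: "complex vec" assume x: "x \<in> carrier_vec (dim_col A)"
  have "norm2_vec (A *\<^sub>v x) \<le> (\<Sum>i<dim_row A. cmod ((A *\<^sub>v x) $ i))"
    unfolding norm2_vec_def by (rule L2_set_le_sum[THEN order_trans]) auto
  also have "\<dots> \<le> (\<Sum>i<dim_row A. L2_set (\<lambda>j. cmod (A $$ (i, j))) {..<dim_col A} * norm2_vec x)"
  proof (rule sum_mono)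
    fix i assume i: "i \<in> {..<dim_row A}"
    have "cmod ((A *\<^sub>v x) $ i) \<le> (\<Sum>j<dim_col A. \<bar>cmod (A $$ (i, j))\<bar> * \<bar>cmod (x $ j)\<bar>)"
      using i x by (subst mult_mat_vec_nth[of A "dim_row A" "dim_col A"])
        (auto simp: norm_mult intro!: sum_norm_le)
    also have "\<dots> \<le> L2_set (\<lambda>j. cmod (A $$ (i, j))) {..<dim_col A} * norm2_vec x"
      using L2_set_mult_ineq[of "\<lambda>j. cmod (A $$ (i, j))" "\<lambda>j. cmod (x $ j)"] x
      by (simp add: norm2_vec_def)
    finally show "cmod ((A *\<^sub>v x) $ i) \<le> L2_set (\<lambda>j. cmod (A $$ (i, j))) {..<dim_col A} * norm2_vec x" .
  qed
  finally show "norm2_vec (A *\<^sub>v x)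
      \<le> (\<Sum>i<dim_row A. L2_set (\<lambda>j. cmod (A $$ (i, j))) {..<dim_col A}) * norm2_vec x"
    by (simp add: sum_distrib_right)
qed

lemma norm2_mult_mat_vec_le:
  assumes x: "x \<in> carrier_vec (dim_col A)"
  shows "norm2_vec (A *\<^sub>v x) \<le> spectral_norm A * norm2_vec x"
proof (cases "norm2_vec x = 0")
  case True
  then have "norm2_vec (A *\<^sub>v x) \<le> 0"
    using norm2_mult_mat_vec_bound[of A] x by (metis mult_zero_right)
  then show ?thesis using True by simp
next
  case False
  define c where "c = complex_of_real (1 / norm2_vec x)"
  obtain K where K: "\<And>x. x \<in> carrier_vec (dim_col A) \<Longrightarrow> norm2_vec (A *\<^sub>v x) \<le> K * norm2_vec x"
    using norm2_mult_mat_vec_bound[of A] by blast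
  have cx: "c \<cdot>\<^sub>v x \<in> carrier_vec (dim_col A)" "norm2_vec (c \<cdot>\<^sub>v x) = 1"
    using False x by (auto simp: norm2_vec_smult c_def norm_divide)
  have "bdd_above {norm2_vec (A *\<^sub>v x) | x. x \<in> carrier_vec (dim_col A) \<and> norm2_vec x = 1}"
    using K by (intro bdd_aboveI[of _ K]) force
  then have "norm2_vec (A *\<^sub>v (c \<cdot>\<^sub>v x)) \<le> spectral_norm A"
    unfolding spectral_norm_def using cx by (intro cSup_upper) auto
  moreover have "A *\<^sub>v (c \<cdot>\<^sub>v x) = c \<cdot>\<^sub>v (A *\<^sub>v x)"
    using x by (intro mult_mat_vec) auto
  ultimately show ?thesis
    using False by (simp add: norm2_vec_smult c_def norm_divide pos_divide_le_eq less_le)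
qed

lemma spectral_norm_le:
  assumes "0 < dim_col A"
    and "\<And>x. x \<in> carrier_vec (dim_col A) \<Longrightarrow> norm2_vec (A *\<^sub>v x) \<le> K * norm2_vec x"
  shows "spectral_norm A \<le> K"
  unfolding spectral_norm_def
proof (rule cSup_least)
  have "norm2_vec (unit_vec (dim_col A) 0) = 1"
    using assms(1) unfolding norm2_vec_def L2_set_def
    by (simp add: sum.remove[of _ 0] unit_vec_def)
  then show "{norm2_vec (A *\<^sub>v x) | x. x \<in> carrier_vec (dim_col A) \<and> norm2_vec x = 1} \<noteq> {}"
    using unit_vec_carrier by blast
qed (use assms(2) in force)

lemma spectral_norm_nonneg:
  assumes "0 < dim_col A"
  shows "0 \<le> spectral_norm A"
proof -
  have "norm2_vec (unit_vec (dim_col A) 0) = 1"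
    using assms(1) unfolding norm2_vec_def L2_set_def
    by (simp add: sum.remove[of _ 0] unit_vec_def)
  then have "norm2_vec (A *\<^sub>v unit_vec (dim_col A) 0) \<le> spectral_norm A"
    using norm2_mult_mat_vec_le[of "unit_vec (dim_col A) 0" A] by simp
  then show ?thesis using norm2_vec_nonneg order_trans by blast
qed

lemma L2_set_cmod_sum_le:
  "L2_set (\<lambda>i. cmod (\<Sum>l\<in>J. f l i)) I \<le> (\<Sum>l\<in>J. L2_set (\<lambda>i. cmod (f l i)) I)"
proof (induction J rule: infinite_finite_induct)
  case (insert l J)
  have "L2_set (\<lambda>i. cmod (\<Sum>l\<in>insert l J. f l i)) I
     \<le> L2_set (\<lambda>i. cmod (f l i) + cmod (\<Sum>l\<in>J. f l i)) I"
    using insert(1,2) by (intro L2_set_mono) (auto intro: norm_triangle_ineq)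
  also have "\<dots> \<le> L2_set (\<lambda>i. cmod (f l i)) I + L2_set (\<lambda>i. cmod (\<Sum>l\<in>J. f l i)) I"
    by (rule L2_set_triangle_ineq)
  finally show ?case
    using insert by simp
qed (simp_all add: L2_set_def)

lemma norm2_eval_mp_le:
  assumes Q: "Q \<in> matpolys k N" and u: "u \<in> carrier_vec N"
  shows "norm2_vec (eval_mp Q z *\<^sub>v u)
    \<le> matpoly_norm k Q * sqrt (\<Sum>l\<le>k. ((cmod z)\<^sup>2) ^ l) * norm2_vec u"
proof -
  have dims: "dim_row Q = N" "dim_col Q = N"
    using Q by (auto simp: matpolys_def)
  have cf: "coeff_mp Q l \<in> carrier_mat N N" for l
    using dims by (auto simp: coeff_mp_def)
  have ev: "eval_mp Q z \<in> carrier_mat N N"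
    using dims by (auto simp: eval_mp_def)
  have nth: "(eval_mp Q z *\<^sub>v u) $ i = (\<Sum>l\<le>k. z ^ l * (coeff_mp Q l *\<^sub>v u) $ i)" if "i < N" for i
  proof -
    have "(eval_mp Q z *\<^sub>v u) $ i = (\<Sum>j<N. (\<Sum>l\<le>k. z ^ l * coeff_mp Q l $$ (i, j)) * u $ j)"
      by (simp add: mult_mat_vec_nth[OF ev u that] eval_mp_eq_sum[OF Q that])
    also have "\<dots> = (\<Sum>l\<le>k. z ^ l * (\<Sum>j<N. coeff_mp Q l $$ (i, j) * u $ j))"
      unfolding sum_distrib_left sum_distrib_right by (subst sum.swap) (simp add: mult.assoc)
    also have "\<dots> = (\<Sum>l\<le>k. z ^ l * (coeff_mp Q l *\<^sub>v u) $ i)"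
      by (simp add: mult_mat_vec_nth[OF cf u that])
    finally show ?thesis .
  qed
  have "norm2_vec (eval_mp Q z *\<^sub>v u)
      = L2_set (\<lambda>i. cmod (\<Sum>l\<le>k. z ^ l * (coeff_mp Q l *\<^sub>v u) $ i)) {..<N}"
    unfolding norm2_vec_def using ev nth by (intro L2_set_cong) auto
  also have "\<dots> \<le> (\<Sum>l\<le>k. L2_set (\<lambda>i. cmod (z ^ l * (coeff_mp Q l *\<^sub>v u) $ i)) {..<N})"
    by (rule L2_set_cmod_sum_le)
  also have "\<dots> = (\<Sum>l\<le>k. cmod z ^ l * norm2_vec (coeff_mp Q l *\<^sub>v u))"
    by (simp add: norm2_vec_def carrier_matD[OF cf] norm_mult norm_power L2_set_right_distrib)
  also have "\<dots> \<le> (\<Sum>l\<le>k. \<bar>spectral_norm (coeff_mp Q l)\<bar> * \<bar>cmod z ^ l\<bar> * norm2_vec u)"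
  proof (rule sum_mono)
    fix l
    have "norm2_vec (coeff_mp Q l *\<^sub>v u) \<le> spectral_norm (coeff_mp Q l) * norm2_vec u"
      using cf[of l] u by (intro norm2_mult_mat_vec_le) auto
    also have "\<dots> \<le> \<bar>spectral_norm (coeff_mp Q l)\<bar> * norm2_vec u"
      by (intro mult_right_mono) auto
    finally have "cmod z ^ l * norm2_vec (coeff_mp Q l *\<^sub>v u)
      \<le> cmod z ^ l * (\<bar>spectral_norm (coeff_mp Q l)\<bar> * norm2_vec u)"
      by (intro mult_left_mono) auto
    then show "cmod z ^ l * norm2_vec (coeff_mp Q l *\<^sub>v u)
      \<le> \<bar>spectral_norm (coeff_mp Q l)\<bar> * \<bar>cmod z ^ l\<bar> * norm2_vec u"
      by (simp add: mult_ac)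
  qed
  also have "\<dots> \<le> L2_set (\<lambda>l. spectral_norm (coeff_mp Q l)) {..k}
      * L2_set (\<lambda>l. cmod z ^ l) {..k} * norm2_vec u"
    unfolding sum_distrib_right[symmetric] by (intro mult_right_mono L2_set_mult_ineq) auto
  also have "\<dots> = matpoly_norm k Q * sqrt (\<Sum>l\<le>k. ((cmod z)\<^sup>2) ^ l) * norm2_vec u"
    by (simp add: L2_set_def matpoly_norm_def power_mult[symmetric] mult.commute)
  finally show ?thesis .
qed

lemma exists_symmetric_interpolation:
  assumes u: "u \<in> carrier_vec N" "u \<noteq> 0\<^sub>v N" and b: "b \<in> carrier_vec N"
  obtains A where "A \<in> carrier_mat N N" "transpose_mat A = A" "A *\<^sub>v u = b"
    "spectral_norm A \<le> norm2_vec b / norm2_vec u"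
proof -
  define r where "r = norm2_vec u"
  have r: "r > 0"
    using u norm2_vec_eq_0_iff[of u] norm2_vec_nonneg[of u] by (auto simp: r_def less_le)
  have N: "N > 0"
    using u by (cases "N = 0") auto
  have "(\<Sum>i<N. (cmod (u $ i / r))\<^sup>2) = (norm2_vec u)\<^sup>2 / r\<^sup>2"
    using u(1) by (simp add: norm2_vec_square norm_divide power_divide sum_divide_distrib)
  then have u1: "(\<Sum>i<N. (cmod (u $ i / r))\<^sup>2) = 1"
    using r by (simp add: r_def)
  obtain B where sym: "\<And>i j. B i j = B j i"
    and Bu: "\<And>i. i \<in> {..<N} \<Longrightarrow> (\<Sum>j<N. B i j * (u $ j / r)) = b $ i / r"
    and Bn: "\<And>y. (\<Sum>i<N. (cmod (\<Sum>j<N. B i j * y j))\<^sup>2)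
           \<le> (\<Sum>i<N. (cmod (b $ i / r))\<^sup>2) * (\<Sum>i<N. (cmod (y i))\<^sup>2)"
    using exists_symmetric_interpolation_unit[OF finite_lessThan u1, of "\<lambda>i. b $ i / r"] by blast
  define A where "A = mat N N (\<lambda>(i, j). B i j)"
  have A: "A \<in> carrier_mat N N" by (simp add: A_def)
  have Ay: "(A *\<^sub>v y) $ i = (\<Sum>j<N. B i j * y $ j)" if "i < N" "y \<in> carrier_vec N" for i y
    unfolding mult_mat_vec_nth[OF A that(2,1)] using that(1) by (simp add: A_def)
  show thesis
  proof (rule that[OF A])
    show "transpose_mat A = A"
      using sym by (intro eq_matI) (auto simp: A_def)
    show "A *\<^sub>v u = b"
    proof (rule eq_vecI)
      fix i assume "i < dim_vec b"
      then have i: "i < N" using b by simp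
      have "(\<Sum>j<N. B i j * u $ j) / r = b $ i / r"
        using Bu[of i] i by (simp add: sum_divide_distrib)
      then show "(A *\<^sub>v u) $ i = b $ i"
        using Ay[OF i u(1)] r by simp
    qed (use b A in auto)
    show "spectral_norm A \<le> norm2_vec b / norm2_vec u"
    proof (rule spectral_norm_le)
      fix y :: "complex vec" assume "y \<in> carrier_vec (dim_col A)"
      then have y: "y \<in> carrier_vec N" using A by simp
      have "(norm2_vec (A *\<^sub>v y))\<^sup>2 = (\<Sum>i<N. (cmod (\<Sum>j<N. B i j * y $ j))\<^sup>2)"
        using A Ay[OF _ y] by (simp add: norm2_vec_square del: index_mult_mat_vec)
      also have "\<dots> \<le> (\<Sum>i<N. (cmod (b $ i / r))\<^sup>2) * (\<Sum>i<N. (cmod (y $ i))\<^sup>2)"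
        by (rule Bn)
      also have "\<dots> = (norm2_vec b / norm2_vec u * norm2_vec y)\<^sup>2"
        using b y r
        by (simp add: norm2_vec_square power_mult_distrib power_divide norm_divide sum_divide_distrib[symmetric] r_def)
      finally show "norm2_vec (A *\<^sub>v y) \<le> norm2_vec b / norm2_vec u * norm2_vec y"
        by (rule power2_le_imp_le) simp
    qed (use A N in auto)
  qed
qed

lemma structured_backward_error_bounds:
  assumes S: "S \<subseteq> matpolys k N" and Q: "Q \<in> carrier_mat N N"
    and u: "u \<in> carrier_vec N" "u \<noteq> 0\<^sub>v N"
    and q: "poly q lam = 1"
    and qS: "\<And>A. A \<in> carrier_mat N N \<Longrightarrow> transpose_mat A = A \<Longrightarrow> map_mat (\<lambda>a. smult a q) A \<in> S"
  shows "norm2_vec (eval_mp Q lam *\<^sub>v u) / (norm2_vec u * sqrt (\<Sum>l\<le>k. ((cmod lam)\<^sup>2) ^ l))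
      \<le> structured_backward_error k S lam u Q" (is "?lower \<le> _")
    and "structured_backward_error k S lam u Q
      \<le> norm2_vec (eval_mp Q lam *\<^sub>v u) / norm2_vec u * sqrt (\<Sum>l\<le>k. (cmod (coeff q l))\<^sup>2)"
      (is "_ \<le> ?upper")
proof -
  define b where "b = eval_mp Q lam *\<^sub>v u"
  define X where "X = {matpoly_norm k \<Delta>Q | \<Delta>Q. \<Delta>Q \<in> S \<and> b + eval_mp \<Delta>Q lam *\<^sub>v u = 0\<^sub>v (dim_row Q)}"
  have X: "structured_backward_error k S lam u Q = Inf X"
    by (simp add: structured_backward_error_def X_def b_def)
  have ev: "eval_mp Q lam \<in> carrier_mat N N"
    using Q by (simp add: eval_mp_def)
  have b: "b \<in> carrier_vec N"
    using ev u by (auto simp: b_def)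
  have N: "N > 0"
    using u by (cases "N = 0") auto
  have r: "norm2_vec u > 0"
    using u norm2_vec_eq_0_iff[of u] norm2_vec_nonneg[of u] by (auto simp: less_le)
  have M: "(\<Sum>l\<le>k. ((cmod lam)\<^sup>2) ^ l) > 0"
    by (rule sum_pos2[of _ 0]) auto
  have lower: "?lower \<le> s" if s: "s \<in> X" for s
  proof -
    obtain \<Delta>Q where D: "s = matpoly_norm k \<Delta>Q" "\<Delta>Q \<in> matpolys k N"
      "b + eval_mp \<Delta>Q lam *\<^sub>v u = 0\<^sub>v N"
      using s S by (auto simp: X_def carrier_matD(1)[OF Q])
    have ev\<Delta>: "eval_mp \<Delta>Q lam \<in> carrier_mat N N"
      using D(2) by (auto simp: matpolys_def eval_mp_def)
    have "eval_mp \<Delta>Q lam *\<^sub>v u = - b"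
    proof (rule eq_vecI)
      fix i assume i: "i < dim_vec (- b)"
      then have "(b + eval_mp \<Delta>Q lam *\<^sub>v u) $ i = 0"
        using b by (simp only: D(3)) simp
      then show "(eval_mp \<Delta>Q lam *\<^sub>v u) $ i = (- b) $ i"
        using i b ev\<Delta> by (simp add: add_eq_0_iff del: index_mult_mat_vec)
    qed (use ev\<Delta> b in auto)
    with norm2_eval_mp_le[OF D(2) u(1), of lam] show ?thesis
      using r M by (simp add: b_def[symmetric] norm2_vec_uminus D(1) pos_divide_le_eq mult_ac)
  qed
  have "- b \<in> carrier_vec N" using b by simp
  from exists_symmetric_interpolation[OF u this]
  obtain A where A: "A \<in> carrier_mat N N" "transpose_mat A = A" "A *\<^sub>v u = - b"
    "spectral_norm A \<le> norm2_vec b / norm2_vec u"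
    by (auto simp: norm2_vec_uminus)
  define \<Delta>Q where "\<Delta>Q = map_mat (\<lambda>a. smult a q) A"
  have "eval_mp \<Delta>Q lam = A"
    using q by (intro eq_matI) (auto simp: eval_mp_def \<Delta>Q_def)
  then have D: "matpoly_norm k \<Delta>Q \<in> X"
    using qS[OF A(1,2)] A(3) b Q by (auto simp: X_def \<Delta>Q_def intro!: exI[of _ \<Delta>Q])
  have coeff: "coeff_mp \<Delta>Q l = coeff q l \<cdot>\<^sub>m A" for l
    by (intro eq_matI) (auto simp: coeff_mp_def \<Delta>Q_def)
  have sn: "spectral_norm (coeff q l \<cdot>\<^sub>m A) \<le> cmod (coeff q l) * (norm2_vec b / norm2_vec u)" for l
  proof (rule spectral_norm_le)
    fix y :: "complex vec" assume y: "y \<in> carrier_vec (dim_col (coeff q l \<cdot>\<^sub>m A))"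
    have "(coeff q l \<cdot>\<^sub>m A) *\<^sub>v y = coeff q l \<cdot>\<^sub>v (A *\<^sub>v y)"
      using y A(1) by (intro eq_vecI) (auto simp: scalar_prod_def sum_distrib_left mult.assoc)
    then have "norm2_vec ((coeff q l \<cdot>\<^sub>m A) *\<^sub>v y) = cmod (coeff q l) * norm2_vec (A *\<^sub>v y)"
      by (simp add: norm2_vec_smult)
    also have "\<dots> \<le> cmod (coeff q l) * (spectral_norm A * norm2_vec y)"
      using y by (intro mult_left_mono norm2_mult_mat_vec_le) auto
    also have "\<dots> \<le> cmod (coeff q l) * (norm2_vec b / norm2_vec u * norm2_vec y)"
      by (intro mult_left_mono mult_right_mono A(4)) auto
    finally show "norm2_vec ((coeff q l \<cdot>\<^sub>m A) *\<^sub>v y)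
        \<le> cmod (coeff q l) * (norm2_vec b / norm2_vec u) * norm2_vec y"
      by (simp add: mult.assoc)
  qed (use A N in auto)
  have "matpoly_norm k \<Delta>Q \<le> sqrt (\<Sum>l\<le>k. (cmod (coeff q l) * (norm2_vec b / norm2_vec u))\<^sup>2)"
    unfolding matpoly_norm_def coeff using A(1) N sn
    by (intro real_sqrt_le_mono sum_mono power_mono spectral_norm_nonneg) auto
  also have "\<dots> = ?upper"
    unfolding power_mult_distrib sum_distrib_right[symmetric] real_sqrt_mult b_def[symmetric]
    by (simp add: mult.commute)
  finally have up: "matpoly_norm k \<Delta>Q \<le> ?upper" .
  show "?lower \<le> structured_backward_error k S lam u Q"
    unfolding X using D lower by (intro cInf_greatest) auto
  have "Inf X \<le> matpoly_norm k \<Delta>Q"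
    using D lower by (intro cInf_lower bdd_belowI) auto
  with up show "structured_backward_error k S lam u Q \<le> ?upper"
    unfolding X by simp
qed

lemma smult_symmetric_mem_T_even:
  assumes "degree q \<le> k" "\<And>z. poly q (- z) = poly q z"
    and A: "A \<in> carrier_mat N N" "transpose_mat A = A"
  shows "map_mat (\<lambda>a. smult a q) A \<in> T_even k N"
proof -
  have sym: "A $$ (j, i) = A $$ (i, j)" if "i < N" "j < N" for i j
    using A that by (metis carrier_matD index_transpose_mat(1))
  have "degree (smult a q) \<le> k" for a
    by (rule order_trans[OF degree_smult_le assms(1)])
  then have "map_mat (\<lambda>a. smult a q) A \<in> matpolys k N"
    using A(1) by (simp add: matpolys_def)
  moreover have "transpose_mat (eval_mp (map_mat (\<lambda>a. smult a q) A) z) =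
      eval_mp (map_mat (\<lambda>a. smult a q) A) (- z)" for z
  proof (rule eq_matI)
    fix i j assume "i < dim_row (eval_mp (map_mat (\<lambda>a. smult a q) A) (- z))"
      "j < dim_col (eval_mp (map_mat (\<lambda>a. smult a q) A) (- z))"
    then have "i < N" "j < N" using A(1) by (simp_all add: eval_mp_def)
    then show "transpose_mat (eval_mp (map_mat (\<lambda>a. smult a q) A) z) $$ (i, j) =
      (eval_mp (map_mat (\<lambda>a. smult a q) A) (- z)) $$ (i, j)"
      using A(1) sym[of i j] by (simp add: eval_mp_def assms(2))
  qed (use A(1) in \<open>simp_all add: eval_mp_def\<close>)
  ultimately show ?thesis by (simp add: T_even_def)
qed

lemma smult_symmetric_mem_T_odd:
  assumes "degree q \<le> k" "\<And>z. poly q (- z) = - poly q z"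
    and A: "A \<in> carrier_mat N N" "transpose_mat A = A"
  shows "map_mat (\<lambda>a. smult a q) A \<in> T_odd k N"
proof -
  have sym: "A $$ (j, i) = A $$ (i, j)" if "i < N" "j < N" for i j
    using A that by (metis carrier_matD index_transpose_mat(1))
  have "degree (smult a q) \<le> k" for a
    by (rule order_trans[OF degree_smult_le assms(1)])
  then have "map_mat (\<lambda>a. smult a q) A \<in> matpolys k N"
    using A(1) by (simp add: matpolys_def)
  moreover have "transpose_mat (eval_mp (map_mat (\<lambda>a. smult a q) A) z) =
      - eval_mp (map_mat (\<lambda>a. smult a q) A) (- z)" for z
  proof (rule eq_matI)
    fix i j assume "i < dim_row (- eval_mp (map_mat (\<lambda>a. smult a q) A) (- z))"
      "j < dim_col (- eval_mp (map_mat (\<lambda>a. smult a q) A) (- z))"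
    then have "i < N" "j < N" using A(1) by (simp_all add: eval_mp_def)
    then show "transpose_mat (eval_mp (map_mat (\<lambda>a. smult a q) A) z) $$ (i, j) =
      (- eval_mp (map_mat (\<lambda>a. smult a q) A) (- z)) $$ (i, j)"
      using A(1) sym[of i j] by (simp add: eval_mp_def assms(2))
  qed (use A(1) in \<open>simp_all add: eval_mp_def\<close>)
  ultimately show ?thesis by (simp add: T_odd_def)
qed

lemma dim_kron_vec [simp]: "dim_vec (kron_vec a b) = dim_vec a * dim_vec b"
  by (simp add: kron_vec_altdef)

lemma norm2_kron_vec: "norm2_vec (kron_vec a b) = norm2_vec a * norm2_vec b"
proof -
  let ?n = "dim_vec b"
  let ?f = "\<lambda>i. (cmod (a $ (i div ?n) * b $ (i mod ?n)))\<^sup>2"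
  have "(norm2_vec (kron_vec a b))\<^sup>2 = (\<Sum>i<dim_vec a * ?n. ?f i)"
    unfolding norm2_vec_square by (simp add: kron_vec_altdef)
  also have "\<dots> = (\<Sum>k<dim_vec a. \<Sum>i\<in>{k * ?n..<k * ?n + ?n}. ?f i)"
    by (rule sum.nat_group[symmetric])
  also have "\<dots> = (\<Sum>k<dim_vec a. \<Sum>i<?n. (cmod (a $ k) * cmod (b $ i))\<^sup>2)"
  proof (rule sum.cong[OF refl])
    fix k
    have "(\<Sum>i\<in>{k * ?n..<k * ?n + ?n}. ?f i) = (\<Sum>i\<in>{0..<?n}. ?f (i + k * ?n))"
      using sum.shift_bounds_nat_ivl[of ?f 0 "k * ?n" ?n] by (simp add: add.commute)
    also have "\<dots> = (\<Sum>i\<in>{0..<?n}. (cmod (a $ k) * cmod (b $ i))\<^sup>2)"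
    proof (rule sum.cong[OF refl])
      fix i assume "i \<in> {0..<?n}"
      moreover from this have "?n \<noteq> 0" by auto
      ultimately have "(i + k * ?n) div ?n = k" "(i + k * ?n) mod ?n = i" by simp_all
      then show "?f (i + k * ?n) = (cmod (a $ k) * cmod (b $ i))\<^sup>2" by (simp add: norm_mult)
    qed
    finally show "(\<Sum>i\<in>{k * ?n..<k * ?n + ?n}. ?f i) = (\<Sum>i<?n. (cmod (a $ k) * cmod (b $ i))\<^sup>2)"
      by (simp add: lessThan_atLeast0)
  qed
  also have "\<dots> = (norm2_vec a * norm2_vec b)\<^sup>2"
    by (simp add: power_mult_distrib norm2_vec_square sum_distrib_left sum_distrib_right)
       (rule sum.swap)
  finally show ?thesis
    by (simp add: power2_eq_iff_nonneg)
qed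

lemma kron_mat_col_mult_vec:
  assumes "x \<in> carrier_vec (dim_col B)"
  shows "kron_mat (col_mat a) B *\<^sub>v x = kron_vec a (B *\<^sub>v x)"
proof (rule eq_vecI)
  fix i assume "i < dim_vec (kron_vec a (B *\<^sub>v x))"
  then have i: "i < dim_vec a * dim_row B" by simp
  then have "dim_row B > 0" by (cases "dim_row B = 0") auto
  with i show "(kron_mat (col_mat a) B *\<^sub>v x) $ i = kron_vec a (B *\<^sub>v x) $ i"
    using assms
    by (simp add: kron_vec_altdef kron_mat_def col_mat_def mat_of_cols_def scalar_prod_def
        less_mult_imp_div_less sum_distrib_left mult.assoc)
qed (simp add: kron_mat_def col_mat_def mat_of_cols_def)

lemma right_ansatz_vector_residual:
  assumes "right_ansatz_vector m n P L v" and L: "L \<in> carrier_mat (m * n) (m * n)"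
    and P: "P \<in> carrier_mat n n" and x: "x \<in> carrier_vec n"
  shows "eval_mp L z *\<^sub>v kron_vec (Lam m z) x = kron_vec v (eval_mp P z *\<^sub>v x)"
proof -
  have "kron_mat (col_mat (Lam m z)) (1\<^sub>m n) *\<^sub>v x = kron_vec (Lam m z) x"
    using x by (simp add: kron_mat_col_mult_vec)
  moreover have "(eval_mp L z * kron_mat (col_mat (Lam m z)) (1\<^sub>m n)) *\<^sub>v x
     = eval_mp L z *\<^sub>v (kron_mat (col_mat (Lam m z)) (1\<^sub>m n) *\<^sub>v x)"
    using L x by (intro assoc_mult_mat_vec[of _ "m * n" "m * n" _ n])
      (auto simp: eval_mp_def kron_mat_def col_mat_def Lam_def)
  moreover have "eval_mp L z * kron_mat (col_mat (Lam m z)) (1\<^sub>m n) = kron_mat (col_mat v) (eval_mp P z)"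
    using assms(1) by (simp add: right_ansatz_vector_def)
  moreover have "kron_mat (col_mat v) (eval_mp P z) *\<^sub>v x = kron_vec v (eval_mp P z *\<^sub>v x)"
    using P x by (intro kron_mat_col_mult_vec) (simp add: eval_mp_def)
  ultimately show ?thesis by simp
qed

lemma norm2_Lam: "norm2_vec (Lam m z) = sqrt (\<Sum>j<m. ((cmod z)\<^sup>2) ^ j)"
proof -
  have "(norm2_vec (Lam m z))\<^sup>2 = (\<Sum>i<m. ((cmod z)\<^sup>2) ^ (m - Suc i))"
    unfolding norm2_vec_square
    by (simp add: Lam_def norm_power power_mult[symmetric] mult.commute)
  also have "\<dots> = (\<Sum>j<m. ((cmod z)\<^sup>2) ^ j)"
    by (rule sum.nat_diff_reindex)
  finally show ?thesis
    by (metis norm2_vec_nonneg real_sqrt_unique)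
qed

lemma sum_power_Suc_le:
  fixes t :: real
  assumes "t \<ge> 0" "m \<ge> 1"
  shows "(\<Sum>l\<le>m. t ^ l) \<le> (1 + t) * (\<Sum>l<m. t ^ l)"
proof -
  have "(\<Sum>l\<le>m. t ^ l) = 1 + t * (\<Sum>l<m. t ^ l)"
    by (simp add: lessThan_Suc_atMost[symmetric] sum.lessThan_Suc_shift sum_distrib_left
        del: sum.lessThan_Suc)
  moreover have "1 \<le> (\<Sum>l<m. t ^ l)"
    using assms sum_mono2[of "{..<m}" "{0}" "\<lambda>l. t ^ l"] by auto
  ultimately show ?thesis by (simp add: algebra_simps)
qed

lemma power_add_power_diff_le:
  fixes t :: real
  assumes "t \<ge> 0" "l \<le> m"
  shows "t ^ l + t ^ (m - l) \<le> 1 + t ^ m"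
proof -
  have "0 \<le> (1 - t ^ l) * (1 - t ^ (m - l))"
  proof (cases "t \<le> 1")
    case True
    then show ?thesis using assms by (simp add: power_le_one)
  next
    case False
    then show ?thesis by (intro mult_nonpos_nonpos) (simp_all add: one_le_power)
  qed
  also have "\<dots> = 1 - t ^ l - t ^ (m - l) + t ^ (l + (m - l))"
    by (simp add: algebra_simps power_add)
  finally show ?thesis using assms by simp
qed

text \<open>
  The interior terms \<open>t^l\<close> (\<open>0 < l < m\<close>) pair up as \<open>t^l + t^(m-l) \<le> 1 + t^m\<close>, and the end terms
  \<open>1\<close> and \<open>t^m\<close> are exactly those that occur only once in \<open>(1 + t) * (\<Sum>l<m. t ^ l)\<close>.
\<close>

lemma sum_power_Suc_ge:
  fixes t :: real
  assumes "t \<ge> 0" "m \<ge> 1"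
  shows "(real m + 1) * ((1 + t) * (\<Sum>l<m. t ^ l)) \<le> 2 * real m * (\<Sum>l\<le>m. t ^ l)"
proof -
  define N where "N = (\<Sum>l<m. t ^ l)"
  have M: "(\<Sum>l\<le>m. t ^ l) = N + t ^ m"
    by (simp add: N_def lessThan_Suc_atMost[symmetric])
  have M': "(\<Sum>l\<le>m. t ^ l) = 1 + t * N"
    by (simp add: N_def lessThan_Suc_atMost[symmetric] sum.lessThan_Suc_shift sum_distrib_left
        del: sum.lessThan_Suc)
  have "(1 + t) * N = (\<Sum>l<m. t ^ l + t ^ Suc (m - Suc l))"
    using sum.nat_diff_reindex[of "\<lambda>l. t ^ l" m]
    by (simp add: N_def sum.distrib distrib_right sum_distrib_left[symmetric])
  also have "\<dots> \<le> (\<Sum>l<m. 1 + t ^ m)"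
  proof (rule sum_mono)
    fix l assume "l \<in> {..<m}"
    then show "t ^ l + t ^ Suc (m - Suc l) \<le> 1 + t ^ m"
      using power_add_power_diff_le[OF assms(1), of l m] by (auto simp: Suc_diff_Suc simp del: power_Suc)
  qed
  finally have "(1 + t) * N \<le> real m * (1 + t ^ m)" by simp
  moreover have "2 * (\<Sum>l\<le>m. t ^ l) = (1 + t) * N + 1 + t ^ m"
    using M M' by (simp add: algebra_simps)
  ultimately show ?thesis
    unfolding N_def[symmetric] by (simp add: algebra_simps)
qed

lemma sum_even_Suc_atMost:
  "(\<Sum>l | l \<le> Suc m \<and> even l. f l) =
     (\<Sum>l | l \<le> m \<and> even l. f l) + (if even (Suc m) then f (Suc m) else (0::real))"
proof -
  have "{l. l \<le> Suc m \<and> even l} = {l. l \<le> m \<and> even l} \<union> (if even (Suc m) then {Suc m} else {})"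
    by (auto simp: le_Suc_eq)
  then show ?thesis by (simp add: sum.union_disjoint)
qed

lemma sum_power_even_terms:
  fixes t :: real
  assumes "t \<ge> 0"
  shows "odd m \<Longrightarrow> (\<Sum>l\<le>m. t ^ l) = (1 + t) * (\<Sum>l | l \<le> m \<and> even l. t ^ l)"
    and "t \<le> 1 \<Longrightarrow> (\<Sum>l\<le>m. t ^ l) \<le> 2 * (\<Sum>l | l \<le> m \<and> even l. t ^ l)"
    and "1 \<le> t \<Longrightarrow> even m \<Longrightarrow> (\<Sum>l\<le>m. t ^ l) \<le> 2 * (\<Sum>l | l \<le> m \<and> even l. t ^ l)"
proof -
  have e0: "{l::nat. l = 0 \<and> even l} = {0}" by auto
  show odd_eq: "(\<Sum>l\<le>m. t ^ l) = (1 + t) * (\<Sum>l | l \<le> m \<and> even l. t ^ l)" if "odd m" for m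
    using that
  proof (induction m rule: induct_nat_012)
    case (ge2 n)
    then show ?case by (simp add: sum_even_Suc_atMost algebra_simps)
  qed (simp_all add: sum_even_Suc_atMost[of _ 0, simplified] e0)
  have even_eq: "(\<Sum>l\<le>m. t ^ l) + t ^ Suc m = (1 + t) * (\<Sum>l | l \<le> m \<and> even l. t ^ l)"
    if "even m" for m
    using odd_eq[of "Suc m"] that by (simp add: sum_even_Suc_atMost)
  have nonneg: "0 \<le> (\<Sum>l | l \<le> m \<and> even l. t ^ l)"
    using assms by (intro sum_nonneg) auto
  {
    assume t: "t \<le> 1"
    have "(\<Sum>l\<le>m. t ^ l) \<le> (1 + t) * (\<Sum>l | l \<le> m \<and> even l. t ^ l)"
      using odd_eq[of m] even_eq[of m] zero_le_power[OF assms, of "Suc m"]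
      by (cases "even m") (simp_all del: power_Suc)
    also have "\<dots> \<le> 2 * (\<Sum>l | l \<le> m \<and> even l. t ^ l)"
      using t nonneg by (intro mult_right_mono) auto
    finally show "(\<Sum>l\<le>m. t ^ l) \<le> 2 * (\<Sum>l | l \<le> m \<and> even l. t ^ l)" .
  }
  assume t: "1 \<le> t" and "even m"
  then show "(\<Sum>l\<le>m. t ^ l) \<le> 2 * (\<Sum>l | l \<le> m \<and> even l. t ^ l)"
  proof (induction m rule: induct_nat_012)
    case (ge2 n)
    have "t ^ Suc n \<le> t ^ Suc (Suc n)"
      using t by (intro power_increasing) auto
    with ge2 show ?case by (simp add: sum_even_Suc_atMost del: power_Suc)
  qed (simp_all add: e0)
qed

text \<open>
  The perturbation polynomial has the coefficients \<open>cnj lam ^ l / E\<close> for even \<open>l\<close>: among the even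
  polynomials \<open>q\<close> with \<open>q(lam) = 1\<close> it is the one of least coefficient norm.
\<close>

lemma backward_error_T_even_bounds:
  fixes lam :: complex
  assumes P: "P \<in> T_even m n" and x: "x \<in> carrier_vec n" "norm2_vec x = 1"
  defines "t \<equiv> (cmod lam)\<^sup>2"
  shows "norm2_vec (eval_mp P lam *\<^sub>v x) / sqrt (\<Sum>l\<le>m. t ^ l)
      \<le> structured_backward_error m (T_even m n) lam x P"
    and "structured_backward_error m (T_even m n) lam x P
      \<le> norm2_vec (eval_mp P lam *\<^sub>v x) / sqrt (\<Sum>l | l \<le> m \<and> even l. t ^ l)"
proof -
  define E where "E = (\<Sum>l | l \<le> m \<and> even l. t ^ l)"
  have E: "E > 0"
    unfolding E_def by (rule sum_pos2[of _ 0]) (auto simp: t_def)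
  define c where "c l = (if even l then cnj lam ^ l / of_real E else 0)" for l
  define q where "q = (\<Sum>l\<le>m. monom (c l) l)"
  have cq: "coeff q l = (if l \<le> m then c l else 0)" for l
    by (simp add: q_def coeff_sum coeff_monom sum.delta')
  have deg: "degree q \<le> m"
    by (rule degree_le) (simp add: cq)
  have pq: "poly q z = (\<Sum>l\<le>m. c l * z ^ l)" for z
    by (simp add: q_def poly_sum poly_monom)
  have "poly q lam = (\<Sum>l | l \<le> m \<and> even l. of_real (t ^ l) / of_real E)"
  proof -
    have "poly q lam = (\<Sum>l\<le>m. if even l then of_real (t ^ l) / of_real E else 0)"
      unfolding pq by (intro sum.cong refl)
        (auto simp: c_def t_def of_real_cmod_square power_mult_distrib mult.commute)
    also have "\<dots> = (\<Sum>l\<in>{l \<in> {..m}. even l}. of_real (t ^ l) / of_real E)"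
      by (rule sum.inter_filter[symmetric]) simp
    finally show ?thesis by simp
  qed
  also have "\<dots> = 1"
    using E by (simp add: sum_divide_distrib[symmetric] E_def flip: of_real_sum of_real_power)
  finally have q1: "poly q lam = 1" .
  have qm: "poly q (- z) = poly q z" for z
    unfolding pq by (intro sum.cong refl) (simp add: c_def)
  have x0: "x \<noteq> 0\<^sub>v n"
    using x norm2_vec_eq_0_iff[of x] by auto
  have "(\<Sum>l\<le>m. (cmod (coeff q l))\<^sup>2) = (\<Sum>l | l \<le> m \<and> even l. t ^ l / E\<^sup>2)"
  proof -
    have "(\<Sum>l\<le>m. (cmod (coeff q l))\<^sup>2) = (\<Sum>l\<le>m. if even l then t ^ l / E\<^sup>2 else 0)"
      by (intro sum.cong refl)
        (auto simp: cq c_def t_def norm_divide norm_power power_divide power_mult[symmetric] mult.commute)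
    also have "\<dots> = (\<Sum>l\<in>{l \<in> {..m}. even l}. t ^ l / E\<^sup>2)"
      by (rule sum.inter_filter[symmetric]) simp
    finally show ?thesis by simp
  qed
  also have "\<dots> = 1 / E"
    using E by (simp add: sum_divide_distrib[symmetric] E_def[symmetric] power2_eq_square)
  finally have nq: "(\<Sum>l\<le>m. (cmod (coeff q l))\<^sup>2) = 1 / E" .
  have sub: "T_even m n \<subseteq> matpolys m n" and Pc: "P \<in> carrier_mat n n"
    using P by (auto simp: T_even_def matpolys_def)
  note bounds = structured_backward_error_bounds[OF sub Pc x(1) x0 q1
      smult_symmetric_mem_T_even[OF deg qm]]
  show "norm2_vec (eval_mp P lam *\<^sub>v x) / sqrt (\<Sum>l\<le>m. t ^ l)
      \<le> structured_backward_error m (T_even m n) lam x P"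
    using bounds(1) x(2) by (simp add: t_def)
  show "structured_backward_error m (T_even m n) lam x P
      \<le> norm2_vec (eval_mp P lam *\<^sub>v x) / sqrt (\<Sum>l | l \<le> m \<and> even l. t ^ l)"
    using bounds(2) x(2) by (simp add: nq real_sqrt_divide E_def)
qed

lemma backward_error_pencil_bounds:
  fixes lam :: complex
  assumes S: "S \<subseteq> matpolys 1 (m * n)" and L: "L \<in> S" and P: "P \<in> carrier_mat n n"
    and v: "right_ansatz_vector m n P L v" "norm2_vec v = 1"
    and x: "x \<in> carrier_vec n" "norm2_vec x = 1" and m: "m \<ge> 1"
    and q: "poly q lam = 1"
    and qS: "\<And>A. A \<in> carrier_mat (m * n) (m * n) \<Longrightarrow> transpose_mat A = A \<Longrightarrow>
      map_mat (\<lambda>a. smult a q) A \<in> S"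
  defines "t \<equiv> (cmod lam)\<^sup>2"
  shows "norm2_vec (eval_mp P lam *\<^sub>v x) / (sqrt (\<Sum>l<m. t ^ l) * sqrt (1 + t))
      \<le> structured_backward_error 1 S lam (kron_vec (Lam m lam) x) L"
    and "structured_backward_error 1 S lam (kron_vec (Lam m lam) x) L
      \<le> norm2_vec (eval_mp P lam *\<^sub>v x) / sqrt (\<Sum>l<m. t ^ l)
        * sqrt ((cmod (coeff q 0))\<^sup>2 + (cmod (coeff q 1))\<^sup>2)"
proof -
  let ?u = "kron_vec (Lam m lam) x"
  have u: "?u \<in> carrier_vec (m * n)"
    using x by (intro carrier_vecI) (simp add: Lam_def)
  have Lc: "L \<in> carrier_mat (m * n) (m * n)"
    using S L by (auto simp: matpolys_def)
  have nu: "norm2_vec ?u = sqrt (\<Sum>l<m. t ^ l)"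
    by (simp add: norm2_kron_vec norm2_Lam x t_def)
  have "(\<Sum>l<m. t ^ l) > 0"
    using m by (intro sum_pos2[of _ 0]) (auto simp: t_def)
  then have u0: "?u \<noteq> 0\<^sub>v (m * n)"
    using nu by auto
  have nr: "norm2_vec (eval_mp L lam *\<^sub>v ?u) = norm2_vec (eval_mp P lam *\<^sub>v x)"
    by (simp add: right_ansatz_vector_residual[OF v(1) Lc P x(1)] norm2_kron_vec v(2))
  have sum01: "(\<Sum>l\<le>1. f l) = f 0 + f 1" for f :: "nat \<Rightarrow> real"
    by simp
  note bounds = structured_backward_error_bounds[OF S Lc u u0 q qS, unfolded nr nu sum01 t_def[symmetric]]
  show "norm2_vec (eval_mp P lam *\<^sub>v x) / (sqrt (\<Sum>l<m. t ^ l) * sqrt (1 + t))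
      \<le> structured_backward_error 1 S lam ?u L"
    using bounds(1) by simp
  show "structured_backward_error 1 S lam ?u L
      \<le> norm2_vec (eval_mp P lam *\<^sub>v x) / sqrt (\<Sum>l<m. t ^ l)
        * sqrt ((cmod (coeff q 0))\<^sup>2 + (cmod (coeff q 1))\<^sup>2)"
    by (rule bounds(2))
qed

lemma error_ratio_bounds:
  fixes \<rho> M N E t w c \<eta>L \<eta>P :: real
  assumes \<rho>: "\<rho> > 0" and t: "t \<ge> 0" and pos: "M > 0" "N > 0" "E > 0"
    and P: "\<rho> / sqrt M \<le> \<eta>P" "\<eta>P \<le> \<rho> / sqrt E"
    and L: "\<rho> / (sqrt N * sqrt (1 + t)) \<le> \<eta>L" "\<eta>L \<le> \<rho> / sqrt N * sqrt c"
    and lower: "w * (N * (1 + t)) \<le> E" and upper: "M * c \<le> 2 * N"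
  shows "sqrt w \<le> \<eta>L / \<eta>P" and "\<eta>L / \<eta>P \<le> sqrt 2"
proof -
  have P0: "\<eta>P > 0"
    using P(1) \<rho> pos by (smt (verit) divide_pos_pos real_sqrt_gt_zero)
  have "sqrt w * sqrt (N * (1 + t)) \<le> sqrt E"
    using lower by (metis real_sqrt_le_mono real_sqrt_mult)
  then have "sqrt w \<le> sqrt E / (sqrt N * sqrt (1 + t))"
    using pos t by (simp add: pos_le_divide_eq real_sqrt_mult)
  also have "\<dots> = (\<rho> / (sqrt N * sqrt (1 + t))) / (\<rho> / sqrt E)"
    using \<rho> pos by simp
  also have "\<dots> \<le> \<eta>L / \<eta>P"
    using P L P0 \<rho> pos t by (intro frac_le) (auto intro: order_trans[rotated])
  finally show "sqrt w \<le> \<eta>L / \<eta>P" .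
  have "\<rho> / (sqrt N * sqrt (1 + t)) > 0"
    using \<rho> pos t by simp
  then have "\<eta>L / \<eta>P \<le> (\<rho> / sqrt N * sqrt c) / (\<rho> / sqrt M)"
    using P L P0 \<rho> pos by (intro frac_le) auto
  also have "\<dots> = sqrt (M * c) / sqrt N"
    using \<rho> by (simp add: real_sqrt_mult)
  also have "\<dots> \<le> sqrt (2 * N) / sqrt N"
    using upper pos by (intro divide_right_mono real_sqrt_le_mono) auto
  also have "\<dots> = sqrt 2"
    using pos by (simp add: real_sqrt_mult)
  finally show "\<eta>L / \<eta>P \<le> sqrt 2" .
qed

lemma weight_bound:
  fixes M N E t k c :: real
  assumes "k > 0" "c > 0" "(k + 1) * ((1 + t) * N) \<le> 2 * k * M" "M \<le> c * E"
  shows "(k + 1) / (2 * k * c) * (N * (1 + t)) \<le> E"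
proof -
  have "(k + 1) * ((1 + t) * N) \<le> 2 * k * (c * E)"
    using assms by (intro order_trans[OF assms(3)] mult_left_mono) auto
  then show ?thesis
    using assms(1,2) by (simp add: pos_divide_le_eq mult_ac)
qed

theorem theorem4p7:
  fixes m n :: nat and P :: matpoly and lam :: complex and x :: "complex vec"
  assumes "m \<ge> 1" and "n \<ge> 1"
    and "P \<in> T_even m n" and "regular_mp P"
    and "x \<in> carrier_vec n" and "norm2_vec x = 1"
    and "eval_mp P lam *\<^sub>v x \<noteq> 0\<^sub>v n"
  shows
    "(\<forall>Le v. Le \<in> L1 m n P \<and> Le \<in> T_even 1 (m * n) \<and> is_linearization m n P Le \<and>
        right_ansatz_vector m n P Le v \<and> norm2_vec v = 1 \<and> v = Sigma_mat m *\<^sub>v v \<longrightarrow>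
        cmod lam \<le> 1 \<longrightarrow>
        (let \<rho> = structured_backward_error 1 (T_even 1 (m * n)) lam (kron_vec (Lam m lam) x) Le
                 / structured_backward_error m (T_even m n) lam x P
         in sqrt ((real m + 1) / (4 * real m)) \<le> \<rho> \<and> \<rho> \<le> sqrt 2)) \<and>
     (\<forall>Lo v. Lo \<in> L1 m n P \<and> Lo \<in> T_odd 1 (m * n) \<and> is_linearization m n P Lo \<and>
        right_ansatz_vector m n P Lo v \<and> norm2_vec v = 1 \<and> v = - (Sigma_mat m *\<^sub>v v) \<longrightarrow>
        cmod lam \<ge> 1 \<longrightarrow>
        (let \<rho> = structured_backward_error 1 (T_odd 1 (m * n)) lam (kron_vec (Lam m lam) x) Lo
                 / structured_backward_error m (T_even m n) lam x P
         in (even m \<longrightarrow> sqrt ((real m + 1) / (4 * real m)) \<le> \<rho> \<and> \<rho> \<le> sqrt 2) \<and>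
            (odd m \<longrightarrow> sqrt ((real m + 1) / (2 * real m)) * (1 / norm2_vec (vec_of_list [1, lam])) \<le> \<rho>
                       \<and> \<rho> \<le> sqrt 2)))"
proof -
  define t where "t = (cmod lam)\<^sup>2"
  define M where "M = (\<Sum>l\<le>m. t ^ l)"
  define N where "N = (\<Sum>l<m. t ^ l)"
  define E where "E = (\<Sum>l | l \<le> m \<and> even l. t ^ l)"
  define \<rho> where "\<rho> = norm2_vec (eval_mp P lam *\<^sub>v x)"
  have t0: "t \<ge> 0" by (simp add: t_def)
  have M: "M > 0" unfolding M_def by (rule sum_pos2[of _ 0]) (auto simp: t_def)
  have N: "N > 0" unfolding N_def using assms(1) by (intro sum_pos2[of _ 0]) (auto simp: t_def)
  have E: "E > 0" unfolding E_def by (rule sum_pos2[of _ 0]) (auto simp: t_def)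
  have Pc: "P \<in> carrier_mat n n"
    using assms(3) by (auto simp: T_even_def matpolys_def)
  have "dim_vec (eval_mp P lam *\<^sub>v x) = n"
    using Pc by (simp add: eval_mp_def)
  then have \<rho>: "\<rho> > 0"
    using assms(7) norm2_vec_eq_0_iff[of "eval_mp P lam *\<^sub>v x"]
    by (auto simp: \<rho>_def less_le)
  note \<eta>P = backward_error_T_even_bounds[OF assms(3,5,6), of lam,
      folded t_def, folded M_def E_def \<rho>_def]
  have MN: "M \<le> (1 + t) * N"
    unfolding M_def N_def by (rule sum_power_Suc_le[OF t0 assms(1)])
  have NM: "(real m + 1) * ((1 + t) * N) \<le> 2 * real m * M"
    unfolding M_def N_def by (rule sum_power_Suc_ge[OF t0 assms(1)])
  have w: "(real m + 1) / (2 * real m * c) * (N * (1 + t)) \<le> E" if "c > 0" "M \<le> c * E" for c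
    using weight_bound[OF _ that(1) NM that(2)] assms(1) by simp
  show ?thesis
  proof (intro conjI allI impI; (elim conjE)?)
    fix L v
    assume L: "L \<in> T_even 1 (m * n)" "right_ansatz_vector m n P L v" "norm2_vec v = 1"
      and lam: "cmod lam \<le> 1"
    have t1: "t \<le> 1" using lam by (simp add: t_def power_le_one)
    have sub: "T_even 1 (m * n) \<subseteq> matpolys 1 (m * n)" by (auto simp: T_even_def)
    have mem: "map_mat (\<lambda>a. smult a 1) A \<in> T_even 1 (m * n)"
      if "A \<in> carrier_mat (m * n) (m * n)" "transpose_mat A = A" for A
      using that by (intro smult_symmetric_mem_T_even) simp_all
    note \<eta>L = backward_error_pencil_bounds[OF sub L(1) Pc L(2,3) assms(5,6,1) poly_1[of lam] mem,
        folded t_def, folded N_def \<rho>_def]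
    have c: "(cmod (coeff 1 0))\<^sup>2 + (cmod (coeff 1 1))\<^sup>2 = 1" by simp
    have lower: "(real m + 1) / (4 * real m) * (N * (1 + t)) \<le> E"
      using w[of 2] sum_power_even_terms(2)[OF t0 t1, of m] by (simp add: M_def E_def)
    have upper: "M * 1 \<le> 2 * N"
      using MN mult_right_mono[of "1 + t" 2 N] t1 N by linarith
    show "let \<rho> = structured_backward_error 1 (T_even 1 (m * n)) lam (kron_vec (Lam m lam) x) L
                 / structured_backward_error m (T_even m n) lam x P
         in sqrt ((real m + 1) / (4 * real m)) \<le> \<rho> \<and> \<rho> \<le> sqrt 2"
      unfolding Let_def
      by (intro conjI error_ratio_bounds[OF \<rho> t0 M N E \<eta>P \<eta>L(1) \<eta>L(2)[unfolded c] lower upper])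
  next
    fix L v
    assume L: "L \<in> T_odd 1 (m * n)" "right_ansatz_vector m n P L v" "norm2_vec v = 1"
      and lam: "1 \<le> cmod lam"
    have t1: "t \<ge> 1" using lam by (simp add: t_def one_le_power)
    have lam0: "lam \<noteq> 0" using lam by auto
    have sub: "T_odd 1 (m * n) \<subseteq> matpolys 1 (m * n)" by (auto simp: T_odd_def)
    have mem: "map_mat (\<lambda>a. smult a [:0, 1 / lam:]) A \<in> T_odd 1 (m * n)"
      if "A \<in> carrier_mat (m * n) (m * n)" "transpose_mat A = A" for A
      using that by (intro smult_symmetric_mem_T_odd) simp_all
    have q: "poly [:0, 1 / lam:] lam = 1"
      using lam0 by simp
    note \<eta>L = backward_error_pencil_bounds[OF sub L(1) Pc L(2,3) assms(5,6,1) q mem,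
        folded t_def, folded N_def \<rho>_def]
    have "M \<le> 2 * t * N"
      using MN mult_right_mono[of "1 + t" "2 * t" N] t1 N by linarith
    then have upper: "M * (1 / t) \<le> 2 * N"
      using t1 by (simp add: pos_divide_le_eq mult_ac)
    have c: "(cmod (coeff [:0, 1 / lam:] 0))\<^sup>2 + (cmod (coeff [:0, 1 / lam:] 1))\<^sup>2 = 1 / t"
      by (simp add: t_def norm_divide power_divide)
    have bounds: "sqrt w \<le> structured_backward_error 1 (T_odd 1 (m * n)) lam (kron_vec (Lam m lam) x) L
        / structured_backward_error m (T_even m n) lam x P \<and>
      structured_backward_error 1 (T_odd 1 (m * n)) lam (kron_vec (Lam m lam) x) L
        / structured_backward_error m (T_even m n) lam x P \<le> sqrt 2"
      if "w * (N * (1 + t)) \<le> E" for w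
      by (intro conjI error_ratio_bounds[OF \<rho> t0 M N E \<eta>P \<eta>L(1) \<eta>L(2)[unfolded c] that upper])
    have norm: "norm2_vec (vec_of_list [1, lam]) = sqrt (1 + t)"
      by (simp add: norm2_vec_def L2_set_def t_def)
    show "let \<rho> = structured_backward_error 1 (T_odd 1 (m * n)) lam (kron_vec (Lam m lam) x) L
                 / structured_backward_error m (T_even m n) lam x P
         in (even m \<longrightarrow> sqrt ((real m + 1) / (4 * real m)) \<le> \<rho> \<and> \<rho> \<le> sqrt 2) \<and>
            (odd m \<longrightarrow> sqrt ((real m + 1) / (2 * real m)) * (1 / norm2_vec (vec_of_list [1, lam])) \<le> \<rho>
                       \<and> \<rho> \<le> sqrt 2)"
    proof (cases "even m")
      case True
      have "(real m + 1) / (4 * real m) * (N * (1 + t)) \<le> E"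
        using w[of 2] sum_power_even_terms(3)[OF t0 t1 True] by (simp add: M_def E_def)
      from bounds[OF this] show ?thesis
        by (simp only: Let_def True simp_thms)
    next
      case False
      have "(real m + 1) / (2 * real m * (1 + t)) * (N * (1 + t)) \<le> E"
        using w[of "1 + t"] sum_power_even_terms(1)[OF t0 False] t0 by (simp add: M_def E_def)
      note b = bounds[OF this]
      have eq: "sqrt ((real m + 1) / (2 * real m * (1 + t)))
          = sqrt ((real m + 1) / (2 * real m)) * (1 / sqrt (1 + t))"
        by (simp add: real_sqrt_divide real_sqrt_mult)
      from b show ?thesis
        by (simp only: Let_def norm eq False simp_thms)
    qed
  qed
qed

end
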